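(* For every $\phi\in\mathcal L_{\mathsf{Xstit}}$: if $\phi$ is valid (globally true on every relational $\mathsf{Xstit}$-model), then $\vdash_{\mathsf{Xstit}}\phi$.
   Context: Fix a finite set of agents $Ag=\{1,\dots,n\}$ and a countable set $Var$ of propositional variables. $\mathcal L_{\mathsf{Xstit}}$ (negation normal form): $\phi ::= p\mid\overline p\mid\phi\wedge\phi\mid\phi\vee\phi\mid\Box\phi\mid\Diamond\phi\mid[A]^x\phi\mid\langle A\rangle^x\phi\mid[X]\phi\mid\langle X\rangle\phi$ with $p\in Var$, $A\subseteq Ag$ (including $\emptyset$ and $Ag$). $\overline\phi$ swaps each operator with its dual ($\wedge/\vee$, $\Box/\Diamond$, $[A]^x/\langle A\rangle^x$, $[X]/\langle X\rangle$) and $p$ with $\overline p$; $\phi\to\psi:=\overline\phi\vee\psi$, $\phi\leftrightarrow\psi:=(\phi\to\psi)\wedge(\psi\to\phi)$. A relational $\mathsf{Xstit}$-frame is $(W,\mathcal R_\Box,\mathcal R_X,\{\mathcal R_A\}_{A\subseteq Ag})$ with $W\ne\emptyset$ and: (D1) $\mathcal R_\Box$ is an equivalence relation; (D2) $\mathcal R_X$ is serial and deterministic (each world has at most one $\mathcal R_X$-successor); (D3) (i) $\mathcal R_\emptyset=\mathcal R_\Box\circ\mathcal R_X$; (ii) $\mathcal R_{Ag}=\mathcal R_X\circ\mathcal R_\Box$; (iii) $\mathcal R_A\subseteq\mathcal R_B$ whenever $B\subseteq A\subseteq Ag$; (iv) for all $A,B\subseteq Ag$ with $A\cap B=\emptyset$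 and all $w_1,w_2,w_3,w_5,w_6\in W$: if $\mathcal R_\Box w_1w_2$ and $\mathcal R_\Box w_1w_3$ then there is $w_4$ with $\mathcal R_\Box w_1w_4$, $(\mathcal R_Aw_4w_5\to\mathcal R_Aw_2w_5)$ and $(\mathcal R_Bw_4w_6\to\mathcal R_Bw_3w_6)$. (Here $\circ$ is relation composition, with $\mathcal R\circ\mathcal S=\{(w,u):\exists v\,(\mathcal Rwv\wedge\mathcal Svu)\}$.) A model adds $V:Var\to\mathcal P(W)$. Satisfaction: $w\models p$ iff $w\in V(p)$; $w\models\overline p$ iff $w\notin V(p)$; $\wedge,\vee$ classical; $\Box/\Diamond$, $[A]^x/\langle A\rangle^x$, $[X]/\langle X\rangle$ are universal/existential quantification over $\mathcal R_\Box(w)$, $\mathcal R_A(w)$, $\mathcal R_X(w)$, where $\mathcal R(w)=\{v:(w,v)\in\mathcal R\}$. Hilbert system $\mathsf{Xstit}$ (all instances, $A\subseteq Ag$, $\alpha\in\{\Box,[A]^x,[X]\}$): $\phi\to(\psi\to\phi)$; $(\overline\psi\to\overline\phi)\to(\phi\to\psi)$; $(\phi\to(\psi\to\chi))\to((\phi\to\psi)\to(\phi\to\chi))$; $\alpha(\phi\to\psi)\to(\alpha\phi\to\alpha\psi)$; $\Box\phi\to\phi$; $\Diamond\phi\to\Box\Diamond\phi$; $[A]^x\phi\to\langle A\rangle^x\phi$; $\langle X\rangle\phi\to[X]\phi$; $\Box[X]\phi\leftrightarrow[\emptyset]^x\phi$; $[Ag]^x\phi\leftrightarrow[X]\Box\phi$;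 $[A]^x\phi\to[B]^x\phi$ for $A\subseteq B\subseteq Ag$; $\Box\phi\vee\Diamond\overline\phi$; $[A]^x\phi\vee\langle A\rangle^x\overline\phi$; $\Diamond[A]^x\phi\wedge\Diamond[B]^x\psi\to\Diamond([A]^x\phi\wedge[B]^x\psi)$ for $A\cap B=\emptyset$; $[X]\phi\vee\langle X\rangle\overline\phi$; rules: modus ponens and, from $\phi$, infer $\alpha\phi$. $\vdash_{\mathsf{Xstit}}\phi$ means $\phi$ is a theorem. *)

theory Defs
  imports "HOL-Library.Countable"
begin

text \<open>
  The agents are the elements of a type \<open>'ag\<close>, of class \<open>finite\<close> in the completeness statement.
  Hence the grand coalition is \<open>UNIV :: 'ag set\<close>, and every term of type \<open>'ag set\<close> is a coalition.
\<close>

datatype ('ag, 'v) fm =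
    Pos 'v
  | Neg 'v
  | Con "('ag, 'v) fm" "('ag, 'v) fm"  (infixr "\<^bold>\<and>" 66)
  | Dis "('ag, 'v) fm" "('ag, 'v) fm"  (infixr "\<^bold>\<or>" 65)
  | Box "('ag, 'v) fm"
  | Dia "('ag, 'v) fm"
  | StitBox "'ag set" "('ag, 'v) fm"
  | StitDia "'ag set" "('ag, 'v) fm"
  | NextBox "('ag, 'v) fm"
  | NextDia "('ag, 'v) fm"

primrec neg :: "('ag, 'v) fm \<Rightarrow> ('ag, 'v) fm" where
  "neg (Pos p) = Neg p"
| "neg (Neg p) = Pos p"
| "neg (\<phi> \<^bold>\<and> \<psi>) = neg \<phi> \<^bold>\<or> neg \<psi>"
| "neg (\<phi> \<^bold>\<or> \<psi>) = neg \<phi> \<^bold>\<and> neg \<psi>"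
| "neg (Box \<phi>) = Dia (neg \<phi>)"
| "neg (Dia \<phi>) = Box (neg \<phi>)"
| "neg (StitBox A \<phi>) = StitDia A (neg \<phi>)"
| "neg (StitDia A \<phi>) = StitBox A (neg \<phi>)"
| "neg (NextBox \<phi>) = NextDia (neg \<phi>)"
| "neg (NextDia \<phi>) = NextBox (neg \<phi>)"

definition Imp :: "('ag, 'v) fm \<Rightarrow> ('ag, 'v) fm \<Rightarrow> ('ag, 'v) fm"  (infixr "\<^bold>\<rightarrow>" 64) where
  "\<phi> \<^bold>\<rightarrow> \<psi> = neg \<phi> \<^bold>\<or> \<psi>"

definition Iff :: "('ag, 'v) fm \<Rightarrow> ('ag, 'v) fm \<Rightarrow> ('ag, 'v) fm"  (infix "\<^bold>\<leftrightarrow>" 63) where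
  "\<phi> \<^bold>\<leftrightarrow> \<psi> = (\<phi> \<^bold>\<rightarrow> \<psi>) \<^bold>\<and> (\<psi> \<^bold>\<rightarrow> \<phi>)"

record ('ag, 'w) frame =
  worlds :: "'w set"
  RBox :: "('w \<times> 'w) set"
  RX :: "('w \<times> 'w) set"
  RStit :: "'ag set \<Rightarrow> ('w \<times> 'w) set"

record ('ag, 'v, 'w) model = "('ag, 'w) frame" +
  val :: "'v \<Rightarrow> 'w set"

text \<open>
  \<^const>\<open>relcomp\<close> composes from left to right: \<open>(w, u) \<in> R O S\<close> iff
  \<open>(w, v) \<in> R\<close> and \<open>(v, u) \<in> S\<close> for some \<open>v\<close>.
  In the last clause (independence of agents) \<open>w\<^sub>4\<close> may depend on \<open>w\<^sub>5\<close> and \<open>w\<^sub>6\<close>.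
\<close>

definition xstit_frame :: "('ag, 'w, 'z) frame_scheme \<Rightarrow> bool" where
  "xstit_frame F \<longleftrightarrow>
     worlds F \<noteq> {} \<and>
     RBox F \<subseteq> worlds F \<times> worlds F \<and>
     RX F \<subseteq> worlds F \<times> worlds F \<and>
     (\<forall>A. RStit F A \<subseteq> worlds F \<times> worlds F) \<and>
     equiv (worlds F) (RBox F) \<and>
     (\<forall>w \<in> worlds F. \<exists>v \<in> worlds F. (w, v) \<in> RX F) \<and>
     single_valued (RX F) \<and>
     RStit F {} = RBox F O RX F \<and>
     RStit F UNIV = RX F O RBox F \<and>
     (\<forall>A B. B \<subseteq> A \<longrightarrow> RStit F A \<subseteq> RStit F B) \<and>
     (\<forall>A B. A \<inter> B = {} \<longrightarrow>
        (\<forall>w\<^sub>1 \<in> worlds F. \<forall>w\<^sub>2 \<in> worlds F. \<forall>w\<^sub>3 \<in> worlds F. \<forall>w\<^sub>5 \<in> worlds F. \<forall>w\<^sub>6 \<in> worlds F.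
           (w\<^sub>1, w\<^sub>2) \<in> RBox F \<and> (w\<^sub>1, w\<^sub>3) \<in> RBox F \<longrightarrow>
           (\<exists>w\<^sub>4 \<in> worlds F. (w\<^sub>1, w\<^sub>4) \<in> RBox F \<and>
              ((w\<^sub>4, w\<^sub>5) \<in> RStit F A \<longrightarrow> (w\<^sub>2, w\<^sub>5) \<in> RStit F A) \<and>
              ((w\<^sub>4, w\<^sub>6) \<in> RStit F B \<longrightarrow> (w\<^sub>3, w\<^sub>6) \<in> RStit F B))))"

definition xstit_model :: "('ag, 'v, 'w) model \<Rightarrow> bool" where
  "xstit_model M \<longleftrightarrow> xstit_frame M \<and> (\<forall>p. val M p \<subseteq> worlds M)"

primrec sat :: "('ag, 'v, 'w) model \<Rightarrow> 'w \<Rightarrow> ('ag, 'v) fm \<Rightarrow> bool"  ("_, _ \<Turnstile> _" [50, 50, 50] 50) where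
  "M, w \<Turnstile> Pos p \<longleftrightarrow> w \<in> val M p"
| "M, w \<Turnstile> Neg p \<longleftrightarrow> w \<notin> val M p"
| "M, w \<Turnstile> \<phi> \<^bold>\<and> \<psi> \<longleftrightarrow> (M, w \<Turnstile> \<phi>) \<and> (M, w \<Turnstile> \<psi>)"
| "M, w \<Turnstile> \<phi> \<^bold>\<or> \<psi> \<longleftrightarrow> (M, w \<Turnstile> \<phi>) \<or> (M, w \<Turnstile> \<psi>)"
| "M, w \<Turnstile> Box \<phi> \<longleftrightarrow> (\<forall>v \<in> RBox M `` {w}. M, v \<Turnstile> \<phi>)"
| "M, w \<Turnstile> Dia \<phi> \<longleftrightarrow> (\<exists>v \<in> RBox M `` {w}. M, v \<Turnstile> \<phi>)"
| "M, w \<Turnstile> StitBox A \<phi> \<longleftrightarrow> (\<forall>v \<in> RStit M A `` {w}. M, v \<Turnstile> \<phi>)"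
| "M, w \<Turnstile> StitDia A \<phi> \<longleftrightarrow> (\<exists>v \<in> RStit M A `` {w}. M, v \<Turnstile> \<phi>)"
| "M, w \<Turnstile> NextBox \<phi> \<longleftrightarrow> (\<forall>v \<in> RX M `` {w}. M, v \<Turnstile> \<phi>)"
| "M, w \<Turnstile> NextDia \<phi> \<longleftrightarrow> (\<exists>v \<in> RX M `` {w}. M, v \<Turnstile> \<phi>)"

text \<open>
  HOL cannot quantify over all types inside a formula, so validity takes the type from which worlds
  are drawn as a parameter; the carrier of a model is an arbitrary nonempty set of that type.
  Completeness takes sets of formulas as worlds. Its hypothesis follows from validity over all models.
\<close>

definition valid :: "'w itself \<Rightarrow> ('ag, 'v) fm \<Rightarrow> bool" where
  "valid _ \<phi> \<longleftrightarrow>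
     (\<forall>M :: ('ag, 'v, 'w) model. xstit_model M \<longrightarrow> (\<forall>w \<in> worlds M. M, w \<Turnstile> \<phi>))"

text \<open>
  Only the cardinality of the type of worlds matters: validity over a type implies validity over every
  type that embeds in it.
\<close>

lemma valid_inj:
  fixes f :: "'u \<Rightarrow> 'w" and \<phi> :: "('ag, 'v) fm"
  assumes f: "inj f" and valid: "valid TYPE('w) \<phi>"
  shows "valid TYPE('u) \<phi>"
  unfolding valid_def
proof (intro allI impI ballI)
  fix M :: "('ag, 'v, 'u) model" and w
  assume M: "xstit_model M" and w: "w \<in> worlds M"
  let ?g = "\<lambda>R. map_prod f f ` R"
  define N :: "('ag, 'v, 'w) model" where
    "N = \<lparr>worlds = f ` worlds M, RBox = ?g (RBox M), RX = ?g (RX M),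
          RStit = (\<lambda>A. ?g (RStit M A)), val = (\<lambda>p. f ` val M p)\<rparr>"
  have N: "worlds N = f ` worlds M" "RBox N = ?g (RBox M)" "RX N = ?g (RX M)"
    "\<And>A. RStit N A = ?g (RStit M A)" "\<And>p. val N p = f ` val M p"
    by (simp_all add: N_def)
  have mem: "(f x, f y) \<in> ?g R \<longleftrightarrow> (x, y) \<in> R" for x y R
    using f by (auto simp: inj_eq)
  have img: "?g R `` {f x} = f ` (R `` {x})" for x R
    using f by (auto simp: inj_eq image_iff)
  have comp: "?g (R O S) = ?g R O ?g S" for R S
  proof (intro equalityI subrelI)
    fix x y assume "(x, y) \<in> ?g R O ?g S"
    then obtain a b c where "(a, b) \<in> R" "(b, c) \<in> S" "x = f a" "y = f c"
      using f by (auto simp: inj_eq)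
    then show "(x, y) \<in> ?g (R O S)" by (force simp: mem)
  qed force
  have equiv: "equiv (f ` worlds M) (?g (RBox M))" if "equiv (worlds M) (RBox M)"
  proof (rule equivI)
    show "?g (RBox M) \<subseteq> f ` worlds M \<times> f ` worlds M"
      using that by (auto simp: equiv_def)
    show "refl_on (f ` worlds M) (?g (RBox M))"
      using that by (auto simp: equiv_def refl_on_def mem simp del: image_iff)
    show "sym (?g (RBox M))"
      using that by (auto simp: equiv_def mem intro!: symI dest: symD)
    show "trans (?g (RBox M))"
      using that f by (auto simp: equiv_def mem inj_eq intro!: transI dest: transD)
  qed
  have sv: "single_valued (?g (RX M))" if "single_valued (RX M)"
    using that f by (auto simp: single_valued_def inj_eq)
  have frame: "xstit_frame M" and val: "\<And>p. val M p \<subseteq> worlds M"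
    using M by (auto simp: xstit_model_def)
  note F = frame[unfolded xstit_frame_def]
  have "?g (RBox M) \<subseteq> f ` worlds M \<times> f ` worlds M" "?g (RX M) \<subseteq> f ` worlds M \<times> f ` worlds M"
    "?g (RStit M A) \<subseteq> f ` worlds M \<times> f ` worlds M" for A
    using F by (auto 0 3)
  moreover have "equiv (f ` worlds M) (?g (RBox M))" "single_valued (?g (RX M))"
    using F equiv sv by simp_all
  moreover have "\<forall>x \<in> worlds M. \<exists>y \<in> worlds M. (x, y) \<in> RX M"
    using F by simp
  moreover have "?g (RStit M {}) = ?g (RBox M O RX M)" "?g (RStit M UNIV) = ?g (RX M O RBox M)"
    using F by simp_all
  moreover have "?g (RStit M A) \<subseteq> ?g (RStit M B)" if "B \<subseteq> A" for A B
    using F that by (intro image_mono) blast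
  ultimately have "xstit_frame N"
    using F unfolding xstit_frame_def N ball_simps bex_simps mem comp[symmetric] by simp
  then have "xstit_model N"
    using val by (auto simp: xstit_model_def N)
  moreover have "(N, f x \<Turnstile> \<psi>) \<longleftrightarrow> (M, x \<Turnstile> \<psi>)" for x and \<psi> :: "('ag, 'v) fm"
    using f by (induction \<psi> arbitrary: x) (simp_all add: N img inj_image_mem_iff)
  ultimately show "M, w \<Turnstile> \<phi>"
    using valid w unfolding valid_def by (metis N(1) imageI)
qed

inductive xstit_thm :: "('ag, 'v) fm \<Rightarrow> bool"  ("\<turnstile> _" [50] 50) where
  Ax1: "\<turnstile> \<phi> \<^bold>\<rightarrow> (\<psi> \<^bold>\<rightarrow> \<phi>)"
| Ax2: "\<turnstile> (neg \<psi> \<^bold>\<rightarrow> neg \<phi>) \<^bold>\<rightarrow> (\<phi> \<^bold>\<rightarrow> \<psi>)"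
| Ax3: "\<turnstile> (\<phi> \<^bold>\<rightarrow> (\<psi> \<^bold>\<rightarrow> \<chi>)) \<^bold>\<rightarrow> ((\<phi> \<^bold>\<rightarrow> \<psi>) \<^bold>\<rightarrow> (\<phi> \<^bold>\<rightarrow> \<chi>))"
| K_Box: "\<turnstile> Box (\<phi> \<^bold>\<rightarrow> \<psi>) \<^bold>\<rightarrow> (Box \<phi> \<^bold>\<rightarrow> Box \<psi>)"
| K_Stit: "\<turnstile> StitBox A (\<phi> \<^bold>\<rightarrow> \<psi>) \<^bold>\<rightarrow> (StitBox A \<phi> \<^bold>\<rightarrow> StitBox A \<psi>)"
| K_Next: "\<turnstile> NextBox (\<phi> \<^bold>\<rightarrow> \<psi>) \<^bold>\<rightarrow> (NextBox \<phi> \<^bold>\<rightarrow> NextBox \<psi>)"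
| T_Box: "\<turnstile> Box \<phi> \<^bold>\<rightarrow> \<phi>"
| Five_Box: "\<turnstile> Dia \<phi> \<^bold>\<rightarrow> Box (Dia \<phi>)"
| D_Stit: "\<turnstile> StitBox A \<phi> \<^bold>\<rightarrow> StitDia A \<phi>"
| Det_Next: "\<turnstile> NextDia \<phi> \<^bold>\<rightarrow> NextBox \<phi>"
| Stit_empty: "\<turnstile> Box (NextBox \<phi>) \<^bold>\<leftrightarrow> StitBox {} \<phi>"
| Stit_grand: "\<turnstile> StitBox UNIV \<phi> \<^bold>\<leftrightarrow> NextBox (Box \<phi>)"
| Stit_mono: "A \<subseteq> B \<Longrightarrow> \<turnstile> StitBox A \<phi> \<^bold>\<rightarrow> StitBox B \<phi>"
| Dual_Box: "\<turnstile> Box \<phi> \<^bold>\<or> Dia (neg \<phi>)"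
| Dual_Stit: "\<turnstile> StitBox A \<phi> \<^bold>\<or> StitDia A (neg \<phi>)"
| Indep: "A \<inter> B = {} \<Longrightarrow>
    \<turnstile> Dia (StitBox A \<phi>) \<^bold>\<and> Dia (StitBox B \<psi>) \<^bold>\<rightarrow> Dia (StitBox A \<phi> \<^bold>\<and> StitBox B \<psi>)"
| Dual_Next: "\<turnstile> NextBox \<phi> \<^bold>\<or> NextDia (neg \<phi>)"
| MP: "\<turnstile> \<phi> \<^bold>\<rightarrow> \<psi> \<Longrightarrow> \<turnstile> \<phi> \<Longrightarrow> \<turnstile> \<psi>"
| Nec_Box: "\<turnstile> \<phi> \<Longrightarrow> \<turnstile> Box \<phi>"
| Nec_Stit: "\<turnstile> \<phi> \<Longrightarrow> \<turnstile> StitBox A \<phi>"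
| Nec_Next: "\<turnstile> \<phi> \<Longrightarrow> \<turnstile> NextBox \<phi>"

end

theory Submission
  imports Defs
begin

text \<open>
  All frame conditions are canonical, so the canonical model on the maximal consistent sets refutes
  every non-theorem. The two conditions that call for a new Lindenbaum extension,
  \<open>\<R>\<^sub>\<emptyset> \<subseteq> \<R>\<^sub>\<box> \<circ> \<R>\<^sub>X\<close> and
  independence of agents, have the same proof: the wanted world must extend \<open>{\<phi>. \<box>\<phi> \<in> w} \<union> S\<close>
  for a set \<open>S\<close> that is closed under conjunction up to provable implication, so it exists as soon as
  \<open>\<diamond>s \<in> w\<close> for each \<open>s \<in> S\<close>. In the first case \<open>S = {[X]\<psi>. \<psi> \<in> u}\<close>; in the second
  \<open>S\<close> consists of the conjunctions of a formula \<open>[A]\<phi>\<close> true at one given world and a formula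
  \<open>[B]\<psi>\<close> true at the other.
\<close>

section \<open>Derivations from assumptions\<close>

lemma neg_neg [simp]: "neg (neg \<phi>) = \<phi>"
  by (induction \<phi>) simp_all

text \<open>The propositional axioms govern only implication and \<open>neg\<close>. Since
  \<open>neg\<close> computes duals, conjunction and disjunction are literally terms of that
  fragment.\<close>

lemma Con_eq_neg_Imp: "\<phi> \<^bold>\<and> \<psi> = neg (\<phi> \<^bold>\<rightarrow> neg \<psi>)"
  by (simp add: Imp_def)

lemma Dis_eq_Imp: "\<phi> \<^bold>\<or> \<psi> = neg \<phi> \<^bold>\<rightarrow> \<psi>"
  by (simp add: Imp_def)

text \<open>Only modus ponens acts on assumptions; necessitation enters solely through
  \<open>provable\<close>. This keeps the deduction theorem valid.\<close>

inductive derives :: "('ag, 'v) fm set \<Rightarrow> ('ag, 'v) fm \<Rightarrow> bool"  (infix "\<tturnstile>" 50)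
  for \<Gamma> where
  assm: "\<phi> \<in> \<Gamma> \<Longrightarrow> \<Gamma> \<tturnstile> \<phi>"
| provable: "\<turnstile> \<phi> \<Longrightarrow> \<Gamma> \<tturnstile> \<phi>"
| mp: "\<Gamma> \<tturnstile> \<phi> \<^bold>\<rightarrow> \<psi> \<Longrightarrow> \<Gamma> \<tturnstile> \<phi> \<Longrightarrow> \<Gamma> \<tturnstile> \<psi>"

lemma derives_empty: "{} \<tturnstile> \<phi> \<Longrightarrow> \<turnstile> \<phi>"
  by (induction rule: derives.induct) (auto intro: xstit_thm.MP)

lemma derives_mono: "\<Gamma> \<tturnstile> \<phi> \<Longrightarrow> \<Gamma> \<subseteq> \<Delta> \<Longrightarrow> \<Delta> \<tturnstile> \<phi>"
  by (induction rule: derives.induct) (auto intro: derives.intros)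

lemma derives_weaken: "\<Gamma> \<tturnstile> \<phi> \<Longrightarrow> \<Gamma> \<tturnstile> \<psi> \<^bold>\<rightarrow> \<phi>"
  by (meson derives.mp derives.provable xstit_thm.Ax1)

lemma derives_Imp_mp: "\<Gamma> \<tturnstile> \<chi> \<^bold>\<rightarrow> (\<phi> \<^bold>\<rightarrow> \<psi>) \<Longrightarrow> \<Gamma> \<tturnstile> \<chi> \<^bold>\<rightarrow> \<phi> \<Longrightarrow> \<Gamma> \<tturnstile> \<chi> \<^bold>\<rightarrow> \<psi>"
  by (meson derives.mp derives.provable xstit_thm.Ax3)

lemma Imp_refl: "\<turnstile> \<phi> \<^bold>\<rightarrow> \<phi>"
  by (meson xstit_thm.Ax1 xstit_thm.Ax3 xstit_thm.MP)

lemma deduction: "insert \<psi> \<Gamma> \<tturnstile> \<phi> \<Longrightarrow> \<Gamma> \<tturnstile> \<psi> \<^bold>\<rightarrow> \<phi>"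
proof (induction rule: derives.induct)
  case (assm \<phi>)
  then show ?case
    by (auto intro: derives_weaken derives.assm derives.provable Imp_refl)
next
  case (provable \<phi>)
  then show ?case
    by (auto intro: derives_weaken derives.provable)
next
  case (mp \<phi> \<chi>)
  then show ?case
    by (blast intro: derives_Imp_mp)
qed

lemma derives_contrapos: "\<Gamma> \<tturnstile> neg \<psi> \<^bold>\<rightarrow> neg \<phi> \<Longrightarrow> \<Gamma> \<tturnstile> \<phi> \<^bold>\<rightarrow> \<psi>"
  by (meson derives.mp derives.provable xstit_thm.Ax2)

lemma derives_explosion: "\<Gamma> \<tturnstile> \<phi> \<Longrightarrow> \<Gamma> \<tturnstile> neg \<phi> \<Longrightarrow> \<Gamma> \<tturnstile> \<psi>"
  by (meson derives.mp derives_contrapos derives_weaken)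

text \<open>From \<open>neg \<phi>\<close> everything follows, in particular \<open>neg (neg \<phi> \<^bold>\<rightarrow> \<phi>)\<close>; now contrapose.\<close>

lemma derives_clavius:
  assumes "\<Gamma> \<tturnstile> neg \<phi> \<^bold>\<rightarrow> \<phi>"
  shows "\<Gamma> \<tturnstile> \<phi>"
proof -
  have "insert (neg \<phi>) \<Gamma> \<tturnstile> neg \<phi>"
    by (simp add: derives.assm)
  moreover have "insert (neg \<phi>) \<Gamma> \<tturnstile> neg \<phi> \<^bold>\<rightarrow> \<phi>"
    using assms derives_mono by blast
  ultimately have "insert (neg \<phi>) \<Gamma> \<tturnstile> neg (neg \<phi> \<^bold>\<rightarrow> \<phi>)"
    by (blast intro: derives_explosion derives.mp)
  then have "\<Gamma> \<tturnstile> (neg \<phi> \<^bold>\<rightarrow> \<phi>) \<^bold>\<rightarrow> \<phi>"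
    by (blast intro: derives_contrapos deduction)
  with assms show ?thesis
    by (rule derives.mp[rotated])
qed

lemma derives_cases:
  assumes "\<Gamma> \<tturnstile> \<psi> \<^bold>\<rightarrow> \<phi>" "\<Gamma> \<tturnstile> neg \<psi> \<^bold>\<rightarrow> \<phi>"
  shows "\<Gamma> \<tturnstile> \<phi>"
proof -
  \<comment> \<open>\<open>neg\<close> is syntactically an involution, so the contraposition rule
    also runs in reverse.\<close>
  have "\<Gamma> \<tturnstile> neg \<phi> \<^bold>\<rightarrow> neg \<psi>"
    using assms(1) by (simp add: derives_contrapos)
  then have "\<Gamma> \<tturnstile> neg \<phi> \<^bold>\<rightarrow> \<phi>"
    using assms(2) by (blast intro: derives_Imp_mp derives_weaken)
  then show ?thesis
    by (rule derives_clavius)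
qed

lemma derives_finite: "\<Gamma> \<tturnstile> \<phi> \<Longrightarrow> \<exists>\<Delta> \<subseteq> \<Gamma>. finite \<Delta> \<and> \<Delta> \<tturnstile> \<phi>"
proof (induction rule: derives.induct)
  case (assm \<phi>)
  then show ?case
    by (intro exI[of _ "{\<phi>}"]) (auto intro: derives.assm)
next
  case (provable \<phi>)
  then show ?case
    by (intro exI[of _ "{}"]) (auto intro: derives.provable)
next
  case (mp \<phi> \<psi>)
  then obtain \<Delta>\<^sub>1 \<Delta>\<^sub>2 where "\<Delta>\<^sub>1 \<subseteq> \<Gamma>" "finite \<Delta>\<^sub>1" "\<Delta>\<^sub>1 \<tturnstile> \<phi> \<^bold>\<rightarrow> \<psi>"
    "\<Delta>\<^sub>2 \<subseteq> \<Gamma>" "finite \<Delta>\<^sub>2" "\<Delta>\<^sub>2 \<tturnstile> \<phi>"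
    by blast
  then show ?case
    by (intro exI[of _ "\<Delta>\<^sub>1 \<union> \<Delta>\<^sub>2"]) (auto intro: derives.mp derives_mono)
qed

text \<open>A deduction theorem for possibly infinite \<open>S\<close>: a common lower bound merges
  the members used for the two premises of modus ponens, so one member carries the whole derivation.
  Nonemptiness supplies a member when only \<open>\<Gamma>\<close> or theorems are used.\<close>

lemma derives_directed:
  assumes "\<Gamma> \<union> S \<tturnstile> \<chi>" "S \<noteq> {}"
    and directed: "\<And>a b. a \<in> S \<Longrightarrow> b \<in> S \<Longrightarrow> \<exists>c \<in> S. (\<turnstile> c \<^bold>\<rightarrow> a) \<and> (\<turnstile> c \<^bold>\<rightarrow> b)"
  shows "\<exists>s \<in> S. \<Gamma> \<tturnstile> s \<^bold>\<rightarrow> \<chi>"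
  using assms(1)
proof (induction rule: derives.induct)
  case (assm \<phi>)
  then show ?case
    using \<open>S \<noteq> {}\<close> by (auto intro: derives.intros derives_weaken Imp_refl)
next
  case (provable \<phi>)
  then show ?case
    using \<open>S \<noteq> {}\<close> by (auto intro: derives.provable derives_weaken)
next
  case (mp \<phi> \<psi>)
  then obtain a b where a: "a \<in> S" "\<Gamma> \<tturnstile> a \<^bold>\<rightarrow> (\<phi> \<^bold>\<rightarrow> \<psi>)" and b: "b \<in> S" "\<Gamma> \<tturnstile> b \<^bold>\<rightarrow> \<phi>"
    by blast
  then obtain c where "c \<in> S" "\<turnstile> c \<^bold>\<rightarrow> a" "\<turnstile> c \<^bold>\<rightarrow> b"
    using directed by blast
  then show ?case
    using a b by (meson derives.provable derives_Imp_mp derives_weaken)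
qed

section \<open>Maximal consistent sets\<close>

text \<open>Consistency is implicit: \<open>w\<close> contains whatever it derives, and never a
  formula together with its negation.\<close>

definition mcs :: "('ag, 'v) fm set \<Rightarrow> bool" where
  "mcs w \<longleftrightarrow> (\<forall>\<phi>. w \<tturnstile> \<phi> \<longrightarrow> \<phi> \<in> w) \<and> (\<forall>\<phi>. neg \<phi> \<in> w \<longleftrightarrow> \<phi> \<notin> w)"

lemma mcs_derives: "mcs w \<Longrightarrow> w \<tturnstile> \<phi> \<Longrightarrow> \<phi> \<in> w"
  by (simp add: mcs_def)

lemma mcs_thm: "mcs w \<Longrightarrow> \<turnstile> \<phi> \<Longrightarrow> \<phi> \<in> w"
  by (simp add: mcs_derives derives.provable)

lemma mcs_neg: "mcs w \<Longrightarrow> neg \<phi> \<in> w \<longleftrightarrow> \<phi> \<notin> w"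
  by (simp add: mcs_def)

section \<open>Connectives in maximal consistent sets\<close>

lemma mcs_Imp:
  assumes "mcs w"
  shows "(\<phi> \<^bold>\<rightarrow> \<psi>) \<in> w \<longleftrightarrow> (\<phi> \<in> w \<longrightarrow> \<psi> \<in> w)"
proof
  show "\<phi> \<in> w \<longrightarrow> \<psi> \<in> w" if "(\<phi> \<^bold>\<rightarrow> \<psi>) \<in> w"
    using assms that by (blast intro: mcs_derives derives.intros)
  have "(\<phi> \<^bold>\<rightarrow> \<psi>) \<in> w" if "neg \<phi> \<in> w"
    using assms that by (blast intro: mcs_derives derives_contrapos derives_weaken derives.assm)
  moreover have "(\<phi> \<^bold>\<rightarrow> \<psi>) \<in> w" if "\<psi> \<in> w"
    using assms that by (blast intro: mcs_derives derives_weaken derives.assm)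
  ultimately show "(\<phi> \<^bold>\<rightarrow> \<psi>) \<in> w" if "\<phi> \<in> w \<longrightarrow> \<psi> \<in> w"
    using assms that by (auto simp: mcs_neg)
qed

lemma mcs_Con: "mcs w \<Longrightarrow> \<phi> \<^bold>\<and> \<psi> \<in> w \<longleftrightarrow> \<phi> \<in> w \<and> \<psi> \<in> w"
  by (simp add: Con_eq_neg_Imp mcs_neg mcs_Imp)

lemma mcs_Dis: "mcs w \<Longrightarrow> \<phi> \<^bold>\<or> \<psi> \<in> w \<longleftrightarrow> \<phi> \<in> w \<or> \<psi> \<in> w"
  by (auto simp: Dis_eq_Imp mcs_neg mcs_Imp)

lemma mcs_Iff: "mcs w \<Longrightarrow> \<phi> \<^bold>\<leftrightarrow> \<psi> \<in> w \<longleftrightarrow> (\<phi> \<in> w \<longleftrightarrow> \<psi> \<in> w)"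
  by (auto simp: Iff_def mcs_Con mcs_Imp)

lemma mcs_thm_Imp: "mcs w \<Longrightarrow> \<turnstile> \<phi> \<^bold>\<rightarrow> \<psi> \<Longrightarrow> \<phi> \<in> w \<Longrightarrow> \<psi> \<in> w"
  using mcs_thm mcs_Imp by blast

lemma mcs_thm_Iff: "mcs w \<Longrightarrow> \<turnstile> \<phi> \<^bold>\<leftrightarrow> \<psi> \<Longrightarrow> \<phi> \<in> w \<longleftrightarrow> \<psi> \<in> w"
  using mcs_thm mcs_Iff by blast

text \<open>A formula in \<open>v\<close> but not in \<open>u\<close> would have its negation in
  \<open>u\<close>, hence in \<open>v\<close>.\<close>

lemma mcs_subset_eq: "mcs u \<Longrightarrow> mcs v \<Longrightarrow> u \<subseteq> v \<Longrightarrow> u = v"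
  by (auto simp: mcs_def)

text \<open>Zorn's lemma runs over the extensions of \<open>\<Gamma>\<close> that do not derive
  \<open>\<phi>\<close>; consistency of a maximal one is a consequence.\<close>

lemma lindenbaum:
  assumes "\<not> \<Gamma> \<tturnstile> \<phi>"
  obtains w where "mcs w" "\<Gamma> \<subseteq> w" "\<phi> \<notin> w"
proof -
  let ?F = "{\<Delta>. \<Gamma> \<subseteq> \<Delta> \<and> \<not> \<Delta> \<tturnstile> \<phi>}"
  have "\<exists>w \<in> ?F. \<forall>\<Delta> \<in> ?F. w \<subseteq> \<Delta> \<longrightarrow> \<Delta> = w"
  proof (rule subset_Zorn_nonempty)
    show "?F \<noteq> {}"
      using assms by blast
    fix C assume C: "C \<noteq> {}" "subset.chain ?F C"
    have "\<not> \<Union>C \<tturnstile> \<phi>"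
    proof
      assume "\<Union>C \<tturnstile> \<phi>"
      then obtain \<Delta> where \<Delta>: "\<Delta> \<subseteq> \<Union>C" "finite \<Delta>" "\<Delta> \<tturnstile> \<phi>"
        using derives_finite by blast
      \<comment> \<open>A finite part of the union of a chain lies in one member of the
        chain.\<close>
      then obtain \<Theta> where "\<Theta> \<in> C" "\<Delta> \<subseteq> \<Theta>"
        using finite_subset_Union_chain[OF \<Delta>(2,1) C] by blast
      then show False
        using C derives_mono[OF \<Delta>(3)] unfolding subset_chain_def by blast
    qed
    then show "\<Union>C \<in> ?F"
      using C unfolding subset_chain_def by blast
  qed
  then obtain w where w: "\<Gamma> \<subseteq> w" "\<not> w \<tturnstile> \<phi>"
    and maximal: "\<And>\<Delta>. w \<subseteq> \<Delta> \<Longrightarrow> \<not> \<Delta> \<tturnstile> \<phi> \<Longrightarrow> \<Delta> = w"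
    by (elim bexE) (simp, metis order_trans)
  have Imp: "w \<tturnstile> \<psi> \<^bold>\<rightarrow> \<phi>" if "\<psi> \<notin> w" for \<psi>
    using maximal[of "insert \<psi> w"] that deduction by blast
  have closed: "\<psi> \<in> w" if "w \<tturnstile> \<psi>" for \<psi>
    using Imp that w(2) derives.mp by blast
  \<comment> \<open>If \<open>\<psi>\<close> and \<open>neg \<psi>\<close> are both absent, case
    distinction derives \<open>\<phi>\<close>; if both are present, explosion does.\<close>
  have "neg \<psi> \<in> w \<longleftrightarrow> \<psi> \<notin> w" for \<psi>
    using Imp w(2) by (meson derives.assm derives_cases derives_explosion)
  then have "mcs w"
    using closed by (simp add: mcs_def)
  then show thesis
    using that w derives.assm by blast
qed

text \<open>Besides giving completeness at the end, this replaces Hilbert-style derivations: a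
  provable implication is checked by membership in an arbitrary maximal consistent set.\<close>

lemma thm_iff_mcs: "\<turnstile> \<phi> \<longleftrightarrow> (\<forall>w. mcs w \<longrightarrow> \<phi> \<in> w)"
proof
  show "\<turnstile> \<phi>" if "\<forall>w. mcs w \<longrightarrow> \<phi> \<in> w"
  proof (rule ccontr)
    assume "\<not> \<turnstile> \<phi>"
    then have "\<not> {} \<tturnstile> \<phi>"
      using derives_empty by blast
    then obtain w where "mcs w" "\<phi> \<notin> w"
      by (rule lindenbaum)
    then show False
      using that by blast
  qed
qed (simp add: mcs_thm)

section \<open>Canonical relations\<close>

text \<open>The box operator is a parameter, so one definition serves \<open>Box\<close>,
  \<open>NextBox\<close> and every \<open>StitBox A\<close>.\<close>

definition canonical :: "(('ag, 'v) fm \<Rightarrow> ('ag, 'v) fm) \<Rightarrow> (('ag, 'v) fm set \<times> ('ag, 'v) fm set) set" where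
  "canonical bx = {(w, v). mcs w \<and> mcs v \<and> {\<phi>. bx \<phi> \<in> w} \<subseteq> v}"

lemma canonical_mcs: "(w, v) \<in> canonical bx \<Longrightarrow> mcs w \<and> mcs v"
  by (simp add: canonical_def)

lemma canonicalD: "(w, v) \<in> canonical bx \<Longrightarrow> bx \<phi> \<in> w \<Longrightarrow> \<phi> \<in> v"
  by (auto simp: canonical_def)

text \<open>The locale fixes no diamond: possibility of \<open>\<phi>\<close> at \<open>w\<close> is
  expressed as \<open>bx (neg \<phi>) \<notin> w\<close>, to which \<open>neg\<close> reduces each
  dual constructor.\<close>

locale normal_modality =
  fixes bx :: "('ag, 'v) fm \<Rightarrow> ('ag, 'v) fm"
  assumes K: "\<turnstile> bx (\<phi> \<^bold>\<rightarrow> \<psi>) \<^bold>\<rightarrow> (bx \<phi> \<^bold>\<rightarrow> bx \<psi>)"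
    and nec: "\<turnstile> \<phi> \<Longrightarrow> \<turnstile> bx \<phi>"
begin

text \<open>Each formula of the derivation can be boxed: \<open>K\<close> carries modus ponens and
  \<open>nec\<close> the theorems.\<close>

lemma derives_mcs: "{\<phi>. bx \<phi> \<in> w} \<tturnstile> \<psi> \<Longrightarrow> mcs w \<Longrightarrow> bx \<psi> \<in> w"
proof (induction rule: derives.induct)
  case (mp \<phi> \<psi>)
  then show ?case
    using mcs_thm_Imp[OF \<open>mcs w\<close> K] mcs_Imp by blast
qed (simp_all add: nec mcs_thm)

lemma mcs_iff_canonical:
  assumes "mcs w"
  shows "bx \<phi> \<in> w \<longleftrightarrow> (\<forall>v. (w, v) \<in> canonical bx \<longrightarrow> \<phi> \<in> v)"
proof
  assume *: "\<forall>v. (w, v) \<in> canonical bx \<longrightarrow> \<phi> \<in> v"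
  \<comment> \<open>Otherwise a Lindenbaum extension is a canonical successor that omits
    \<open>\<phi>\<close>.\<close>
  have "{\<phi>. bx \<phi> \<in> w} \<tturnstile> \<phi>"
  proof (rule ccontr)
    assume "\<not> {\<phi>. bx \<phi> \<in> w} \<tturnstile> \<phi>"
    then obtain v where "mcs v" "{\<phi>. bx \<phi> \<in> w} \<subseteq> v" "\<phi> \<notin> v"
      by (rule lindenbaum)
    then show False
      using * assms by (simp add: canonical_def)
  qed
  then show "bx \<phi> \<in> w"
    using assms by (rule derives_mcs)
qed (blast dest: canonicalD)

lemma mcs_neg_iff_canonical:
  assumes "mcs w"
  shows "bx (neg \<phi>) \<notin> w \<longleftrightarrow> (\<exists>v. (w, v) \<in> canonical bx \<and> \<phi> \<in> v)"
  unfolding mcs_iff_canonical[OF assms] using canonical_mcs mcs_neg by blast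

lemma mono: "\<turnstile> \<phi> \<^bold>\<rightarrow> \<psi> \<Longrightarrow> \<turnstile> bx \<phi> \<^bold>\<rightarrow> bx \<psi>"
  by (rule xstit_thm.MP[OF K nec])

lemma mcs_Con_iff:
  assumes "mcs w"
  shows "bx (\<phi> \<^bold>\<and> \<psi>) \<in> w \<longleftrightarrow> bx \<phi> \<in> w \<and> bx \<psi> \<in> w"
  unfolding mcs_iff_canonical[OF assms] using mcs_Con canonical_mcs by blast

lemma canonical_extension:
  assumes "mcs w" "S \<noteq> {}"
    and "\<And>a b. a \<in> S \<Longrightarrow> b \<in> S \<Longrightarrow> \<exists>c \<in> S. (\<turnstile> c \<^bold>\<rightarrow> a) \<and> (\<turnstile> c \<^bold>\<rightarrow> b)"
    and possible: "\<And>s. s \<in> S \<Longrightarrow> bx (neg s) \<notin> w"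
  obtains v where "(w, v) \<in> canonical bx" "S \<subseteq> v"
proof -
  let ?T = "{\<phi>. bx \<phi> \<in> w}"
  obtain s\<^sub>0 where s\<^sub>0: "s\<^sub>0 \<in> S"
    using \<open>S \<noteq> {}\<close> by blast
  \<comment> \<open>\<open>lindenbaum\<close> asks for an underivable formula; the negation of any
    fixed member of \<open>S\<close> will do.\<close>
  have "\<not> ?T \<union> S \<tturnstile> neg s\<^sub>0"
  proof
    assume "?T \<union> S \<tturnstile> neg s\<^sub>0"
    then obtain s where s: "s \<in> S" "?T \<tturnstile> s \<^bold>\<rightarrow> neg s\<^sub>0"
      using derives_directed[OF _ assms(2,3)] by blast
    \<comment> \<open>As \<open>c\<close> implies both \<open>s\<close> and
      \<open>s\<^sub>0\<close>, the derived implication from \<open>s\<close> to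
      \<open>neg s\<^sub>0\<close> refutes \<open>c\<close>.\<close>
    obtain c where c: "c \<in> S" "\<turnstile> c \<^bold>\<rightarrow> s" "\<turnstile> c \<^bold>\<rightarrow> s\<^sub>0"
      using assms(3) s(1) s\<^sub>0 by blast
    have "(s \<^bold>\<rightarrow> neg s\<^sub>0) \<^bold>\<rightarrow> neg c \<in> u" if "mcs u" for u
      using that mcs_thm[OF that c(2)] mcs_thm[OF that c(3)] by (auto simp: mcs_Imp mcs_neg)
    then have "\<turnstile> (s \<^bold>\<rightarrow> neg s\<^sub>0) \<^bold>\<rightarrow> neg c"
      by (simp add: thm_iff_mcs)
    then have "bx (neg c) \<in> w"
      using s(2) \<open>mcs w\<close> by (blast intro: derives_mcs derives.mp derives.provable)
    then show False
      using possible c(1) by blast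
  qed
  then obtain v where "mcs v" "?T \<union> S \<subseteq> v"
    by (rule lindenbaum)
  then show thesis
    using that \<open>mcs w\<close> by (auto simp: canonical_def)
qed

end

section \<open>The three kinds of modality and their frame conditions\<close>

interpretation Box: normal_modality Box
  by unfold_locales (rule xstit_thm.K_Box xstit_thm.Nec_Box; assumption?)+

interpretation Stit: normal_modality "StitBox A" for A
  by unfold_locales (rule xstit_thm.K_Stit xstit_thm.Nec_Stit; assumption?)+

interpretation Next: normal_modality NextBox
  by unfold_locales (rule xstit_thm.K_Next xstit_thm.Nec_Next; assumption?)+

text \<open>Axiom T gives reflexivity. Axiom 5 pulls boxed formulas back along the relation, which
  together with T gives symmetry; with symmetry it also pushes them forward, which gives
  transitivity.\<close>

lemma equiv_canonical_Box: "equiv {w. mcs w} (canonical Box)"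
proof -
  have T: "\<phi> \<in> w" if "mcs w" "Box \<phi> \<in> w" for \<phi> and w :: "('ag, 'v) fm set"
    using that mcs_thm_Imp xstit_thm.T_Box by blast
  have euclid: "Box \<phi> \<in> w" if "(w, v) \<in> canonical Box" "Box \<phi> \<in> v"
    for \<phi> and w v :: "('ag, 'v) fm set"
  proof (rule ccontr)
    assume "Box \<phi> \<notin> w"
    then have "Dia (neg \<phi>) \<in> w"
      using that mcs_neg[of w "Box \<phi>"] canonical_mcs by auto
    then have "Dia (neg \<phi>) \<in> v"
      using that canonicalD canonical_mcs mcs_thm_Imp xstit_thm.Five_Box by blast
    then show False
      using that mcs_neg[of v "Box \<phi>"] canonical_mcs by auto
  qed
  have sym: "(v, w) \<in> canonical Box" if "(w, v) \<in> canonical Box" for w v :: "('ag, 'v) fm set"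
    using that euclid[OF that] T by (auto simp: canonical_def)
  have trans: "(w, u) \<in> canonical Box" if "(w, v) \<in> canonical Box" "(v, u) \<in> canonical Box"
    for w v u :: "('ag, 'v) fm set"
    using that euclid[OF sym[OF that(1)]] by (auto simp: canonical_def)
  show ?thesis
  proof (rule equivI)
    show "canonical Box \<subseteq> {w. mcs w} \<times> {w. mcs w}"
      by (auto simp: canonical_def)
    show "refl_on {w. mcs w} (canonical Box)"
      using T by (auto simp: refl_on_def canonical_def)
  qed (use sym trans in \<open>blast intro: symI transI\<close>)+
qed

lemma mcs_Dia: "mcs w \<Longrightarrow> Dia \<phi> \<in> w \<longleftrightarrow> Box (neg \<phi>) \<notin> w"
  using mcs_neg[of w "Box (neg \<phi>)"] by simp

text \<open>Determinism gives one direction and seriality the other; together they make the set of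
  formulas true next negation complete.\<close>

lemma mcs_NextBox_neg:
  assumes "mcs w"
  shows "NextBox (neg \<phi>) \<in> w \<longleftrightarrow> NextBox \<phi> \<notin> w"
proof
  have "NextDia (neg \<phi>) \<in> w" if "NextBox \<phi> \<notin> w"
    using that assms mcs_neg[of w "NextBox \<phi>"] by simp
  then show "NextBox (neg \<phi>) \<in> w" if "NextBox \<phi> \<notin> w"
    using that assms mcs_thm_Imp xstit_thm.Det_Next by blast
  show "NextBox \<phi> \<notin> w" if "NextBox (neg \<phi>) \<in> w"
  proof
    assume "NextBox \<phi> \<in> w"
    \<comment> \<open>Seriality of \<open>[X]\<close> is inherited from that of \<open>[Ag]\<close>, since \<open>[X]\<bottom>\<close> implies \<open>[X]\<box>\<bottom>\<close>.\<close>
    have "\<turnstile> (\<phi> \<^bold>\<and> neg \<phi>) \<^bold>\<rightarrow> Box (\<phi> \<^bold>\<and> neg \<phi>)"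
      by (simp add: thm_iff_mcs mcs_Imp mcs_Con mcs_neg)
    then have "NextBox (Box (\<phi> \<^bold>\<and> neg \<phi>)) \<in> w"
      using assms that \<open>NextBox \<phi> \<in> w\<close> Next.mcs_Con_iff Next.mono mcs_thm_Imp by blast
    then have "StitBox UNIV (\<phi> \<^bold>\<and> neg \<phi>) \<in> w"
      using assms mcs_thm_Iff xstit_thm.Stit_grand by blast
    then have "StitDia UNIV (\<phi> \<^bold>\<and> neg \<phi>) \<in> w"
      using assms mcs_thm_Imp xstit_thm.D_Stit by blast
    \<comment> \<open>The formula boxed here is the dual of the contradiction and also the unfolding
      of an implication from \<open>\<phi>\<close> to itself, so its box is a theorem.\<close>
    then have "StitBox UNIV (neg \<phi> \<^bold>\<or> \<phi>) \<notin> w"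
      using assms mcs_neg[of w "StitBox UNIV (neg \<phi> \<^bold>\<or> \<phi>)"] by simp
    then show False
      using assms mcs_thm xstit_thm.Nec_Stit Imp_refl unfolding Imp_def by blast
  qed
qed

lemma mcs_next: "mcs w \<Longrightarrow> mcs {\<phi>. NextBox \<phi> \<in> w}"
  using Next.derives_mcs mcs_NextBox_neg by (auto simp: mcs_def[of "{\<phi>. NextBox \<phi> \<in> w}"])

text \<open>The set of formulas true next is already maximal consistent, so a successor containing
  it must equal it. Seriality and determinism of the relation can be read off.\<close>

lemma canonical_Next_iff:
  "(w, v) \<in> canonical NextBox \<longleftrightarrow> mcs w \<and> v = {\<phi>. NextBox \<phi> \<in> w}"
  using mcs_next mcs_subset_eq by (auto simp: canonical_def dest: mcs_subset_eq[rotated 2])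

text \<open>The intermediate world is the explicit successor under \<open>NextBox\<close>, so
  unfolding the axiom suffices.\<close>

lemma canonical_Stit_grand: "canonical (StitBox UNIV) = canonical NextBox O canonical Box"
proof -
  have "StitBox UNIV \<phi> \<in> w \<longleftrightarrow> NextBox (Box \<phi>) \<in> w" if "mcs w" for \<phi> and w :: "('ag, 'v) fm set"
    using that mcs_thm_Iff xstit_thm.Stit_grand by blast
  then show ?thesis
    by (auto simp: relcomp_unfold canonical_Next_iff) (auto simp: canonical_def mcs_next)
qed

lemma mcs_Stit_empty: "mcs w \<Longrightarrow> StitBox {} \<phi> \<in> w \<longleftrightarrow> Box (NextBox \<phi>) \<in> w"
  using mcs_thm_Iff xstit_thm.Stit_empty by blast

lemma canonical_Stit_empty: "canonical (StitBox {}) = canonical Box O canonical NextBox"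
proof (intro equalityI subrelI)
  fix w u :: "('ag, 'v) fm set"
  assume "(w, u) \<in> canonical Box O canonical NextBox"
  then show "(w, u) \<in> canonical (StitBox {})"
    by (auto simp: canonical_def mcs_Stit_empty)
next
  fix w u :: "('ag, 'v) fm set"
  assume wu: "(w, u) \<in> canonical (StitBox {})"
  then have w: "mcs w" and u: "mcs u"
    by (simp_all add: canonical_mcs)
  \<comment> \<open>For \<open>u\<close> to be the successor of \<open>v\<close>, it is enough that
    \<open>v\<close> contains \<open>NextBox\<close> of every member of \<open>u\<close>: inclusion
    between maximal consistent sets is equality.\<close>
  obtain v where v: "(w, v) \<in> canonical Box" "NextBox ` u \<subseteq> v"
  proof (rule Box.canonical_extension[OF w, of "NextBox ` u"])
    show "NextBox ` u \<noteq> {}"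
      using mcs_thm[OF u Imp_refl] by blast
  next
    fix a b assume "a \<in> NextBox ` u" "b \<in> NextBox ` u"
    then obtain \<phi> \<psi> where ab: "a = NextBox \<phi>" "b = NextBox \<psi>" "\<phi> \<in> u" "\<psi> \<in> u"
      by blast
    then have "NextBox (\<phi> \<^bold>\<and> \<psi>) \<in> NextBox ` u"
      using u by (simp add: mcs_Con)
    moreover have "\<turnstile> NextBox (\<phi> \<^bold>\<and> \<psi>) \<^bold>\<rightarrow> a" "\<turnstile> NextBox (\<phi> \<^bold>\<and> \<psi>) \<^bold>\<rightarrow> b"
      by (simp_all add: ab thm_iff_mcs mcs_Imp Next.mcs_Con_iff)
    ultimately show "\<exists>c \<in> NextBox ` u. (\<turnstile> c \<^bold>\<rightarrow> a) \<and> (\<turnstile> c \<^bold>\<rightarrow> b)"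
      by blast
  next
    fix s assume "s \<in> NextBox ` u"
    then obtain \<psi> where \<psi>: "s = NextBox \<psi>" "\<psi> \<in> u"
      by blast
    show "Box (neg s) \<notin> w"
    proof
      assume "Box (neg s) \<in> w"
      \<comment> \<open>\<open>neg s\<close> is \<open>NextDia (neg \<psi>)\<close>, which
        determinism strengthens to \<open>NextBox (neg \<psi>)\<close> under the box.\<close>
      then have "Box (NextBox (neg \<psi>)) \<in> w"
        using w \<psi>(1) Box.mono[OF xstit_thm.Det_Next] mcs_thm_Imp by fastforce
      then have "neg \<psi> \<in> u"
        using wu w canonicalD mcs_Stit_empty by blast
      then show False
        using u \<psi>(2) mcs_neg by blast
    qed
  qed
  have "mcs v"
    using v canonical_mcs by blast
  moreover have "u \<subseteq> {\<phi>. NextBox \<phi> \<in> v}"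
    using v(2) by blast
  ultimately have "(v, u) \<in> canonical NextBox"
    using u mcs_next mcs_subset_eq by (simp add: canonical_Next_iff) blast
  then show "(w, u) \<in> canonical Box O canonical NextBox"
    using v(1) by blast
qed

lemma canonical_Stit_antimono: "B \<subseteq> A \<Longrightarrow> canonical (StitBox A) \<subseteq> canonical (StitBox B)"
  using mcs_thm_Imp xstit_thm.Stit_mono by (fastforce simp: canonical_def)

text \<open>This is stronger than the frame condition: one \<open>w\<^sub>4\<close> serves all
  successors \<open>u\<close>, instead of depending on \<open>w\<^sub>5\<close> and
  \<open>w\<^sub>6\<close>.\<close>

lemma canonical_indep:
  fixes w\<^sub>1 w\<^sub>2 w\<^sub>3 :: "('ag, 'v) fm set"
  assumes "A \<inter> B = {}" and w\<^sub>2: "(w\<^sub>1, w\<^sub>2) \<in> canonical Box" and w\<^sub>3: "(w\<^sub>1, w\<^sub>3) \<in> canonical Box"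
  obtains w\<^sub>4 where "(w\<^sub>1, w\<^sub>4) \<in> canonical Box"
    "\<And>u. (w\<^sub>4, u) \<in> canonical (StitBox A) \<Longrightarrow> (w\<^sub>2, u) \<in> canonical (StitBox A)"
    "\<And>u. (w\<^sub>4, u) \<in> canonical (StitBox B) \<Longrightarrow> (w\<^sub>3, u) \<in> canonical (StitBox B)"
proof -
  let ?S = "{StitBox A \<phi> \<^bold>\<and> StitBox B \<psi> |\<phi> \<psi>. StitBox A \<phi> \<in> w\<^sub>2 \<and> StitBox B \<psi> \<in> w\<^sub>3}"
  have mcs: "mcs w\<^sub>1" "mcs w\<^sub>2" "mcs w\<^sub>3"
    using w\<^sub>2 w\<^sub>3 canonical_mcs by blast+
  \<comment> \<open>A trivially true partner, which makes \<open>?S\<close> nonempty and later lets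
    each conjunct be extracted alone.\<close>
  have top: "StitBox C (\<phi> \<^bold>\<rightarrow> \<phi>) \<in> w" if "mcs w" for C \<phi> and w :: "('ag, 'v) fm set"
    using that mcs_thm xstit_thm.Nec_Stit Imp_refl by blast
  obtain w\<^sub>4 where w\<^sub>4: "(w\<^sub>1, w\<^sub>4) \<in> canonical Box" "?S \<subseteq> w\<^sub>4"
  proof (rule Box.canonical_extension[OF mcs(1), of ?S])
    show "?S \<noteq> {}"
      using top[OF mcs(2), of A] top[OF mcs(3), of B] by blast
  next
    fix a b assume "a \<in> ?S" "b \<in> ?S"
    then obtain \<phi> \<psi> \<phi>' \<psi>' where ab:
      "a = StitBox A \<phi> \<^bold>\<and> StitBox B \<psi>" "StitBox A \<phi> \<in> w\<^sub>2" "StitBox B \<psi> \<in> w\<^sub>3"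
      "b = StitBox A \<phi>' \<^bold>\<and> StitBox B \<psi>'" "StitBox A \<phi>' \<in> w\<^sub>2" "StitBox B \<psi>' \<in> w\<^sub>3"
      by blast
    let ?c = "StitBox A (\<phi> \<^bold>\<and> \<phi>') \<^bold>\<and> StitBox B (\<psi> \<^bold>\<and> \<psi>')"
    have "?c \<in> ?S"
      using ab mcs by (auto simp: Stit.mcs_Con_iff)
    moreover have "\<turnstile> ?c \<^bold>\<rightarrow> a" "\<turnstile> ?c \<^bold>\<rightarrow> b"
      by (simp_all add: ab thm_iff_mcs mcs_Imp mcs_Con Stit.mcs_Con_iff)
    ultimately show "\<exists>c \<in> ?S. (\<turnstile> c \<^bold>\<rightarrow> a) \<and> (\<turnstile> c \<^bold>\<rightarrow> b)"
      by blast
  next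
    fix s assume "s \<in> ?S"
    then obtain \<phi> \<psi> where s:
      "s = StitBox A \<phi> \<^bold>\<and> StitBox B \<psi>" "StitBox A \<phi> \<in> w\<^sub>2" "StitBox B \<psi> \<in> w\<^sub>3"
      by blast
    \<comment> \<open>\<open>w\<^sub>2\<close> and \<open>w\<^sub>3\<close> witness these
      possibilities; the independence axiom then joins them at a single world.\<close>
    have "Dia (StitBox A \<phi>) \<in> w\<^sub>1" "Dia (StitBox B \<psi>) \<in> w\<^sub>1"
      using s w\<^sub>2 w\<^sub>3 mcs canonicalD mcs_neg by (metis mcs_Dia)+
    then have "Dia s \<in> w\<^sub>1"
      using mcs_thm_Imp[OF mcs(1) xstit_thm.Indep[OF assms(1)]] mcs(1) s(1) by (simp add: mcs_Con)
    then show "Box (neg s) \<notin> w\<^sub>1"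
      using mcs(1) mcs_Dia by blast
  qed
  then have "mcs w\<^sub>4"
    using canonical_mcs by blast
  then have "StitBox A \<phi> \<in> w\<^sub>4 \<and> StitBox B \<psi> \<in> w\<^sub>4" if "StitBox A \<phi> \<in> w\<^sub>2" "StitBox B \<psi> \<in> w\<^sub>3" for \<phi> \<psi>
    using w\<^sub>4(2) that mcs_Con by blast
  then have "\<And>\<phi>. StitBox A \<phi> \<in> w\<^sub>2 \<Longrightarrow> StitBox A \<phi> \<in> w\<^sub>4" "\<And>\<phi>. StitBox B \<phi> \<in> w\<^sub>3 \<Longrightarrow> StitBox B \<phi> \<in> w\<^sub>4"
    using top[OF mcs(2)] top[OF mcs(3)] by meson+
  then show thesis
    using that[OF w\<^sub>4(1)] mcs by (auto simp: canonical_def)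
qed

section \<open>The canonical model\<close>

definition canonical_model :: "('ag, 'v, ('ag, 'v) fm set) model" where
  "canonical_model = \<lparr>worlds = {w. mcs w}, RBox = canonical Box, RX = canonical NextBox,
     RStit = (\<lambda>A. canonical (StitBox A)), val = (\<lambda>p. {w. mcs w \<and> Pos p \<in> w})\<rparr>"

lemma canonical_model_simps [simp]:
  "worlds canonical_model = {w. mcs w}"
  "RBox canonical_model = canonical Box"
  "RX canonical_model = canonical NextBox"
  "RStit canonical_model A = canonical (StitBox A)"
  "val canonical_model p = {w. mcs w \<and> Pos p \<in> w}"
  by (simp_all add: canonical_model_def)

text \<open>The premise supplies nonemptiness of the carrier.\<close>

lemma xstit_model_canonical:
  assumes "mcs (w :: ('ag, 'v) fm set)"
  shows "xstit_model (canonical_model :: ('ag, 'v, ('ag, 'v) fm set) model)"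
proof -
  have worlds: "canonical bx \<subseteq> {w. mcs w} \<times> {w. mcs w}" for bx :: "('ag, 'v) fm \<Rightarrow> ('ag, 'v) fm"
    by (auto simp: canonical_def)
  have "xstit_frame (canonical_model :: ('ag, 'v, ('ag, 'v) fm set) model)"
    unfolding xstit_frame_def canonical_model_simps
  proof (intro conjI allI impI ballI)
    show "{w :: ('ag, 'v) fm set. mcs w} \<noteq> {}"
      using assms by blast
    show "\<exists>v \<in> {w. mcs w}. (u, v) \<in> canonical NextBox" if "u \<in> {w. mcs w}" for u :: "('ag, 'v) fm set"
      using that mcs_next by (auto simp: canonical_Next_iff)
    show "single_valued (canonical NextBox :: (('ag, 'v) fm set \<times> _) set)"
      by (auto simp: single_valued_def canonical_Next_iff)
  next
    fix A B :: "'ag set" and w\<^sub>1 w\<^sub>2 w\<^sub>3 w\<^sub>5 w\<^sub>6 :: "('ag, 'v) fm set"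
    assume "A \<inter> B = {}" "(w\<^sub>1, w\<^sub>2) \<in> canonical Box \<and> (w\<^sub>1, w\<^sub>3) \<in> canonical Box"
    then obtain w\<^sub>4 where "(w\<^sub>1, w\<^sub>4) \<in> canonical Box"
      "(w\<^sub>4, w\<^sub>5) \<in> canonical (StitBox A) \<longrightarrow> (w\<^sub>2, w\<^sub>5) \<in> canonical (StitBox A)"
      "(w\<^sub>4, w\<^sub>6) \<in> canonical (StitBox B) \<longrightarrow> (w\<^sub>3, w\<^sub>6) \<in> canonical (StitBox B)"
      using canonical_indep by metis
    then show "\<exists>w\<^sub>4 \<in> {w. mcs w}. (w\<^sub>1, w\<^sub>4) \<in> canonical Box \<and>
        ((w\<^sub>4, w\<^sub>5) \<in> canonical (StitBox A) \<longrightarrow> (w\<^sub>2, w\<^sub>5) \<in> canonical (StitBox A)) \<and>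
        ((w\<^sub>4, w\<^sub>6) \<in> canonical (StitBox B) \<longrightarrow> (w\<^sub>3, w\<^sub>6) \<in> canonical (StitBox B))"
      using canonical_mcs by blast
  qed (rule worlds equiv_canonical_Box canonical_Stit_empty canonical_Stit_grand
      canonical_Stit_antimono; assumption?)+
  then show ?thesis
    by (auto simp: xstit_model_def)
qed

lemma truth_lemma: "mcs w \<Longrightarrow> canonical_model, w \<Turnstile> \<phi> \<longleftrightarrow> \<phi> \<in> w"
proof (induction \<phi> arbitrary: w)
  case (Neg p)
  then show ?case
    using mcs_neg[of w "Pos p"] by simp
next
  case (Box \<phi>)
  then show ?case
    using canonical_mcs unfolding sat.simps canonical_model_simps Box.mcs_iff_canonical[OF Box.prems]
    by blast
next
  case (Dia \<phi>)
  \<comment> \<open>Each diamond case passes to the dual box, where the existence of successors was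
    proved.\<close>
  then have "Dia \<phi> \<in> w \<longleftrightarrow> Box (neg \<phi>) \<notin> w"
    using mcs_neg[of w "Dia \<phi>"] by simp
  also have "\<dots> \<longleftrightarrow> (\<exists>v. (w, v) \<in> canonical Box \<and> \<phi> \<in> v)"
    by (rule Box.mcs_neg_iff_canonical[OF Dia.prems])
  finally show ?case
    using Dia.IH canonical_mcs unfolding sat.simps canonical_model_simps by blast
next
  case (StitBox A \<phi>)
  then show ?case
    using canonical_mcs unfolding sat.simps canonical_model_simps Stit.mcs_iff_canonical[OF StitBox.prems]
    by blast
next
  case (StitDia A \<phi>)
  then have "StitDia A \<phi> \<in> w \<longleftrightarrow> StitBox A (neg \<phi>) \<notin> w"
    using mcs_neg[of w "StitDia A \<phi>"] by simp
  also have "\<dots> \<longleftrightarrow> (\<exists>v. (w, v) \<in> canonical (StitBox A) \<and> \<phi> \<in> v)"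
    by (rule Stit.mcs_neg_iff_canonical[OF StitDia.prems])
  finally show ?case
    using StitDia.IH canonical_mcs unfolding sat.simps canonical_model_simps by blast
next
  case (NextBox \<phi>)
  then show ?case
    using canonical_mcs unfolding sat.simps canonical_model_simps Next.mcs_iff_canonical[OF NextBox.prems]
    by blast
next
  case (NextDia \<phi>)
  then have "NextDia \<phi> \<in> w \<longleftrightarrow> NextBox (neg \<phi>) \<notin> w"
    using mcs_neg[of w "NextDia \<phi>"] by simp
  also have "\<dots> \<longleftrightarrow> (\<exists>v. (w, v) \<in> canonical NextBox \<and> \<phi> \<in> v)"
    by (rule Next.mcs_neg_iff_canonical[OF NextDia.prems])
  finally show ?case
    using NextDia.IH canonical_mcs unfolding sat.simps canonical_model_simps by blast
qed (auto simp: mcs_Con mcs_Dis)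

theorem theorem9:
  fixes \<phi> :: "('ag::finite, 'v::countable) fm"
  assumes "valid TYPE(('ag, 'v) fm set) \<phi>"
  shows "\<turnstile> \<phi>"
  unfolding thm_iff_mcs
proof (intro allI impI)
  fix w :: "('ag, 'v) fm set"
  assume w: "mcs w"
  \<comment> \<open>The set \<open>w\<close> is both the world of evaluation and the witness that
    the canonical model is nonempty.\<close>
  then have "canonical_model, w \<Turnstile> \<phi>"
    using assms xstit_model_canonical[OF w] by (simp add: valid_def)
  then show "\<phi> \<in> w"
    using w by (simp add: truth_lemma)
qed

end
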